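(* Let $\mathcal{X}\subset H(\mathbb{D})$ be a Banach space of analytic functions on $\mathbb{D}$ that contains the constant functions and whose closed unit ball is compact with respect to the compact open topology. Let $g\in H(\mathbb{D})$ and let $\varphi\colon\mathbb{D}\to\mathbb{D}$ be analytic. (i) If the weight $v$ is normal, then $$\|T_g^\varphi\|_{\mathcal{X}\to H_v^\infty}\asymp\sup_{z\in\mathbb{D}}(1-|z|)v(z)|(g\circ\varphi)'(z)|\,\|\delta_{\varphi(z)}\|_{\mathcal{X}\to\mathbb{C}}.$$ (ii) For any weight $v$, $$\|T_g^\varphi\|_{\mathcal{X}\to\mathcal{B}_v^\infty}=\sup_{z\in\mathbb{D}}v(z)|(g\circ\varphi)'(z)|\,\|\delta_{\varphi(z)}\|_{\mathcal{X}\to\mathbb{C}}.$$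
   Context: $\mathbb{D}$ is the open unit disc and $H(\mathbb{D})$ the space of analytic functions on $\mathbb{D}$. The generalized Volterra operator is $T_g^\varphi(f)(z)=\int_0^{\varphi(z)}f(\xi)g'(\xi)\,d\xi$, $z\in\mathbb{D}$, $f\in H(\mathbb{D})$. $\delta_z(f)=f(z)$ is the evaluation functional, and $\|\delta_z\|_{\mathcal{X}\to\mathbb{C}}$ its norm on $\mathcal{X}$. A weight is a continuous strictly positive function $v\colon\mathbb{D}\to\mathbb{R}$ with $\lim_{|z|\to1}v(z)=0$. It is normal if $v(z)=v(|z|)$ for all $z$, $v$ is non-increasing in $|z|$, $\inf_{k\in\mathbb{N}}\limsup_{n\to\infty}\frac{v(1-2^{-n-k})}{v(1-2^{-n})}<1$ and $\sup_{n\in\mathbb{N}}\frac{v(1-2^{-n})}{v(1-2^{-n-1})}<\infty$. $H_v^\infty=\{f\in H(\mathbb{D}):\|f\|_{H_v^\infty}=\sup_{z\in\mathbb{D}}v(z)|f(z)|<\infty\}$ and $\mathcal{B}_v^\infty=\{f\in H(\mathbb{D}):\|f\|_{\mathcal{B}_v^\infty}=|f(0)|+\sup_{z\in\mathbb{D}} v(z)|f'(z)|<\infty\}$. $A\lesssim B$ means that there is a positive constant $c$, not depending on properties of $A$ and $B$, such that $A\le cB$; $A\asymp B$ means that both $A\lesssim B$ and $B\lesssim A$ hold. Both sides take values in $[0,\infty]$, the operator norm being $\infty$ when the operator does not map $\mathcal{X}$ boundedly into the target space.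
   Formalization: The upper bounds in (i) and (ii) are proved only when φ(0)=0, since they fail e.g. for g(z)=z, φ≡1/2, X=H^∞; for general φ the lower bounds hold, and finiteness of the right-hand side still implies that the operator is bounded. *)

theory Defs
  imports "HOL-Complex_Analysis.Complex_Analysis"
begin

abbreviation disc :: "complex set" where
  "disc \<equiv> ball 0 1"

text \<open>A function on the disc is represented by its extension by zero to the whole plane, so that
  equality of functions on the disc is equality in HOL and the pointwise operations are those of
  the plane.\<close>

definition on_disc :: "(complex \<Rightarrow> complex) \<Rightarrow> complex \<Rightarrow> complex" where
  "on_disc f = (\<lambda>z. if z \<in> disc then f z else 0)"

definition H_disc :: "(complex \<Rightarrow> complex) set" where
  "H_disc = {f. f holomorphic_on disc \<and> (\<forall>z. z \<notin> disc \<longrightarrow> f z = 0)}"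

definition compact_open :: "(complex \<Rightarrow> complex) topology" where
  "compact_open = topology_generated_by
     {{f \<in> H_disc. f ` K \<subseteq> U} | K U. compact K \<and> K \<subseteq> disc \<and> open U}"

locale analytic_banach_space =
  fixes X :: "(complex \<Rightarrow> complex) set" and N :: "(complex \<Rightarrow> complex) \<Rightarrow> real"
  assumes subset_H: "X \<subseteq> H_disc"
    and zero_mem: "(\<lambda>z. 0) \<in> X"
    and add_mem: "\<And>f g. f \<in> X \<Longrightarrow> g \<in> X \<Longrightarrow> (\<lambda>z. f z + g z) \<in> X"
    and scale_mem: "\<And>c f. f \<in> X \<Longrightarrow> (\<lambda>z. c * f z) \<in> X"
    and norm_nonneg: "\<And>f. f \<in> X \<Longrightarrow> 0 \<le> N f"
    and norm_eq_0: "\<And>f. f \<in> X \<Longrightarrow> N f = 0 \<longleftrightarrow> f = (\<lambda>z. 0)"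
    and norm_scale: "\<And>c f. f \<in> X \<Longrightarrow> N (\<lambda>z. c * f z) = cmod c * N f"
    and norm_triangle: "\<And>f g. f \<in> X \<Longrightarrow> g \<in> X \<Longrightarrow> N (\<lambda>z. f z + g z) \<le> N f + N g"
    and complete: "Metric_space.mcomplete X (\<lambda>f g. N (\<lambda>z. f z - g z))"

definition closed_unit_ball ::
  "(complex \<Rightarrow> complex) set \<Rightarrow> ((complex \<Rightarrow> complex) \<Rightarrow> real) \<Rightarrow> (complex \<Rightarrow> complex) set" where
  "closed_unit_ball X N = {f \<in> X. N f \<le> 1}"

text \<open>The standing hypotheses on the domain space: it contains the constants, and its closed unit
  ball is compact in the compact-open topology.\<close>

definition admissible_space ::
  "(complex \<Rightarrow> complex) set \<Rightarrow> ((complex \<Rightarrow> complex) \<Rightarrow> real) \<Rightarrow> bool" where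
  "admissible_space X N \<longleftrightarrow> analytic_banach_space X N \<and> (\<forall>c. on_disc (\<lambda>z. c) \<in> X)
     \<and> compactin compact_open (closed_unit_ball X N)"

definition weight :: "(complex \<Rightarrow> real) \<Rightarrow> bool" where
  "weight v \<longleftrightarrow> continuous_on disc v \<and> (\<forall>z\<in>disc. 0 < v z)
     \<and> (v \<longlongrightarrow> 0) (filtercomap cmod (at_left 1))"

definition normal_weight :: "(complex \<Rightarrow> real) \<Rightarrow> bool" where
  "normal_weight v \<longleftrightarrow> weight v
     \<and> (\<forall>z\<in>disc. v z = v (of_real (cmod z)))
     \<and> (\<forall>z\<in>disc. \<forall>w\<in>disc. cmod z \<le> cmod w \<longrightarrow> v w \<le> v z)
     \<and> (INF k::nat. limsup (\<lambda>n. ereal (v (1 - 1 / 2 ^ (n + k)) / v (1 - 1 / 2 ^ n)))) < 1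
     \<and> (SUP n::nat. ereal (v (1 - 1 / 2 ^ n) / v (1 - 1 / 2 ^ (n + 1)))) < \<infinity>"

definition Hv_norm :: "(complex \<Rightarrow> real) \<Rightarrow> (complex \<Rightarrow> complex) \<Rightarrow> ennreal" where
  "Hv_norm v f = (SUP z\<in>disc. ennreal (v z * cmod (f z)))"

definition Hv :: "(complex \<Rightarrow> real) \<Rightarrow> (complex \<Rightarrow> complex) set" where
  "Hv v = {f \<in> H_disc. Hv_norm v f < \<infinity>}"

definition Bv_norm :: "(complex \<Rightarrow> real) \<Rightarrow> (complex \<Rightarrow> complex) \<Rightarrow> ennreal" where
  "Bv_norm v f = ennreal (cmod (f 0)) + (SUP z\<in>disc. ennreal (v z * cmod (deriv f z)))"

definition Bv :: "(complex \<Rightarrow> real) \<Rightarrow> (complex \<Rightarrow> complex) set" where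
  "Bv v = {f \<in> H_disc. Bv_norm v f < \<infinity>}"

text \<open>The norm of a linear map from \<open>X\<close> to the space \<open>Y\<close> normed by \<open>nY\<close>; it is infinite both when
  the map does not send \<open>X\<close> into \<open>Y\<close> and when it does but is unbounded.\<close>

definition op_norm ::
  "(complex \<Rightarrow> complex) set \<Rightarrow> ((complex \<Rightarrow> complex) \<Rightarrow> real) \<Rightarrow> 'b set \<Rightarrow> ('b \<Rightarrow> ennreal)
     \<Rightarrow> ((complex \<Rightarrow> complex) \<Rightarrow> 'b) \<Rightarrow> ennreal" where
  "op_norm X N Y nY T =
     (if T ` X \<subseteq> Y then (SUP f\<in>closed_unit_ball X N. nY (T f)) else \<infinity>)"

definition eval_norm ::
  "(complex \<Rightarrow> complex) set \<Rightarrow> ((complex \<Rightarrow> complex) \<Rightarrow> real) \<Rightarrow> complex \<Rightarrow> ennreal" where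
  "eval_norm X N z = op_norm X N (UNIV :: complex set) (\<lambda>c. ennreal (cmod c)) (\<lambda>f. f z)"

text \<open>The integrand is holomorphic on the disc, so the integral from \<open>0\<close> to \<open>\<phi> z\<close> does not depend
  on the path; the segment is used.\<close>

definition volterra ::
  "(complex \<Rightarrow> complex) \<Rightarrow> (complex \<Rightarrow> complex) \<Rightarrow> (complex \<Rightarrow> complex) \<Rightarrow> complex \<Rightarrow> complex" where
  "volterra g \<phi> f =
     on_disc (\<lambda>z. contour_integral (linepath 0 (\<phi> z)) (\<lambda>\<xi>. f \<xi> * deriv g \<xi>))"

text \<open>The quantities below involve \<open>T\<close> only through the derivative of \<open>T f\<close>, whereas the norms of
  \<open>T\<close> also see \<open>T f 0\<close>, the integral of \<open>f * deriv g\<close> from \<open>0\<close> to \<open>\<phi> 0\<close>. If \<open>\<phi>\<close> is a nonzero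
  constant and \<open>g z = z\<close>, then these quantities vanish although \<open>T \<noteq> 0\<close>. Hence they bound the
  norms of \<open>T\<close> from above only when \<open>\<phi> 0 = 0\<close>; for other \<open>\<phi>\<close> their finiteness still implies
  that \<open>T\<close> is bounded.\<close>

definition Hv_quantity ::
  "(complex \<Rightarrow> complex) set \<Rightarrow> ((complex \<Rightarrow> complex) \<Rightarrow> real) \<Rightarrow> (complex \<Rightarrow> real)
     \<Rightarrow> (complex \<Rightarrow> complex) \<Rightarrow> (complex \<Rightarrow> complex) \<Rightarrow> ennreal" where
  "Hv_quantity X N v g \<phi> =
     (SUP z\<in>disc. ennreal ((1 - cmod z) * v z * cmod (deriv (g \<circ> \<phi>) z)) * eval_norm X N (\<phi> z))"

definition Bv_quantity ::
  "(complex \<Rightarrow> complex) set \<Rightarrow> ((complex \<Rightarrow> complex) \<Rightarrow> real) \<Rightarrow> (complex \<Rightarrow> real)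
     \<Rightarrow> (complex \<Rightarrow> complex) \<Rightarrow> (complex \<Rightarrow> complex) \<Rightarrow> ennreal" where
  "Bv_quantity X N v g \<phi> =
     (SUP z\<in>disc. ennreal (v z * cmod (deriv (g \<circ> \<phi>) z)) * eval_norm X N (\<phi> z))"

end

theory Submission
  imports Defs
begin

text \<open>Write \<open>T f\<close> for \<open>volterra g \<phi> f\<close>. On the disc \<open>T f\<close> is \<open>G \<circ> \<phi> - G 0\<close> with \<open>G\<close> a primitive of
  \<open>f * deriv g\<close>, so by the chain rule its derivative is \<open>(f \<circ> \<phi>) * deriv (g \<circ> \<phi>)\<close>: the integral has
  disappeared. The supremum over the unit ball of \<open>X\<close> of \<open>cmod (f (\<phi> z))\<close> is the norm of the
  evaluation at \<open>\<phi> z\<close>, and suprema commute. Therefore each of the two quantities is the supremum,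
  over the unit ball, of a weighted supremum norm of the derivative of \<open>T f\<close>
  (\<open>weighted_eval_quantity_eq\<close>).

  For the Bloch-type space this supremum norm is the norm of \<open>T f\<close> except for \<open>cmod (T f 0)\<close>.
  The compactness of the unit ball makes \<open>T f 0\<close> bounded over the ball
  (\<open>unit_ball_uniformly_bounded\<close>, \<open>volterra_at_0_bounded\<close>), and \<open>T f 0 = 0\<close> if \<open>\<phi> 0 = 0\<close>.

  For \<open>Hv\<close> one compares, for any holomorphic \<open>F\<close>, the supremum of \<open>v * cmod F\<close> with the supremum \<open>M\<close>
  of \<open>(1 - cmod z) * v z * cmod (deriv F z)\<close>. The Cauchy estimate on the disc about \<open>z\<close> of half
  the distance to the boundary bounds \<open>M\<close>, since halving that distance changes a normal weight by
  a bounded factor only (\<open>weighted_Cauchy_estimate\<close>). Conversely, with \<open>u n\<close> the value of \<open>v\<close> at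
  \<open>1 - 1 / 2 ^ n\<close>, crossing the annulus between the radii \<open>1 - 1 / 2 ^ n\<close> and \<open>1 - 1 / 2 ^ (n + 1)\<close>
  changes \<open>F\<close> by at most \<open>M / u (n + 1)\<close>. Normality makes \<open>u\<close> decay geometrically along steps of
  a fixed length \<open>k\<close>, so the sum of these changes is dominated by its last terms and \<open>v * cmod F\<close> is
  bounded by a multiple of \<open>cmod (F 0) + M\<close> (\<open>weighted_growth_estimate\<close>). The constants depend on
  the weight alone.\<close>

section \<open>The Volterra operator and its derivative\<close>

lemma segment_subset_disc: "w \<in> disc \<Longrightarrow> closed_segment 0 w \<subseteq> disc"
  by (rule closed_segment_subset) auto

lemma volterra_via_primitive:
  assumes f: "f holomorphic_on disc" and g: "g holomorphic_on disc" and \<phi>: "\<phi> ` disc \<subseteq> disc"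
  obtains G where "\<And>w. w \<in> disc \<Longrightarrow> (G has_field_derivative f w * deriv g w) (at w)"
    and "volterra g \<phi> f = on_disc (\<lambda>z. G (\<phi> z) - G 0)"
proof -
  have hol: "(\<lambda>w. f w * deriv g w) holomorphic_on disc"
    by (intro holomorphic_intros f holomorphic_deriv g) auto
  obtain G where G: "\<And>w. w \<in> disc \<Longrightarrow> (G has_field_derivative f w * deriv g w) (at w)"
    using holomorphic_convex_primitive'[OF convex_ball open_ball hol] by (metis at_within_open convex_ball open_ball)
  have "contour_integral (linepath 0 (\<phi> z)) (\<lambda>\<xi>. f \<xi> * deriv g \<xi>) = G (\<phi> z) - G 0"
    if "z \<in> disc" for z
  proof -
    have "\<phi> z \<in> disc" using \<phi> that by blast
    then have "path_image (linepath 0 (\<phi> z)) \<subseteq> disc"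
      unfolding path_image_linepath by (rule segment_subset_disc)
    then have "((\<lambda>w. f w * deriv g w) has_contour_integral
        (G (pathfinish (linepath 0 (\<phi> z))) - G (pathstart (linepath 0 (\<phi> z))))) (linepath 0 (\<phi> z))"
      by (rule contour_integral_primitive[rotated 2])
         (rule has_field_derivative_at_within[OF G], assumption, rule valid_path_linepath)
    then show ?thesis
      by (simp add: contour_integral_unique)
  qed
  then have "volterra g \<phi> f = on_disc (\<lambda>z. G (\<phi> z) - G 0)"
    unfolding volterra_def on_disc_def by (intro ext) auto
  with G that show thesis by blast
qed

lemma volterra_has_derivative:
  assumes f: "f holomorphic_on disc" and g: "g holomorphic_on disc"
    and \<phi>: "\<phi> holomorphic_on disc" "\<phi> ` disc \<subseteq> disc" and z: "z \<in> disc"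
  shows "(volterra g \<phi> f has_field_derivative f (\<phi> z) * deriv (g \<circ> \<phi>) z) (at z)"
proof -
  obtain G where G: "\<And>w. w \<in> disc \<Longrightarrow> (G has_field_derivative f w * deriv g w) (at w)"
    and eq: "volterra g \<phi> f = on_disc (\<lambda>z. G (\<phi> z) - G 0)"
    using volterra_via_primitive[OF f g \<phi>(2)] by blast
  have \<phi>z: "\<phi> z \<in> disc" using \<phi>(2) z by blast
  have d\<phi>: "(\<phi> has_field_derivative deriv \<phi> z) (at z)"
    using \<phi>(1) z by (auto intro: holomorphic_derivI)
  have dg: "(g has_field_derivative deriv g (\<phi> z)) (at (\<phi> z))"
    using g \<phi>z by (auto intro: holomorphic_derivI)
  have chain: "deriv (g \<circ> \<phi>) z = deriv g (\<phi> z) * deriv \<phi> z"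
    using DERIV_chain[OF dg d\<phi>] by (rule DERIV_imp_deriv)
  have "((\<lambda>z. G (\<phi> z) - G 0) has_field_derivative f (\<phi> z) * deriv g (\<phi> z) * deriv \<phi> z) (at z)"
    using DERIV_diff[OF DERIV_chain2[OF G[OF \<phi>z] d\<phi>] DERIV_const] by simp
  then have "(volterra g \<phi> f has_field_derivative f (\<phi> z) * deriv g (\<phi> z) * deriv \<phi> z) (at z)"
    by (rule has_field_derivative_transform_within_open[where S = disc])
       (use z in \<open>auto simp: eq on_disc_def\<close>)
  then show ?thesis by (simp add: chain mult.assoc)
qed

lemma volterra_in_H_disc:
  assumes "f holomorphic_on disc" "g holomorphic_on disc"
    "\<phi> holomorphic_on disc" "\<phi> ` disc \<subseteq> disc"
  shows "volterra g \<phi> f \<in> H_disc"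
proof -
  have "volterra g \<phi> f holomorphic_on disc"
    using volterra_has_derivative[OF assms] open_ball holomorphic_on_open by blast
  then show ?thesis by (auto simp: H_disc_def volterra_def on_disc_def)
qed

lemma volterra_scale:
  assumes f: "f holomorphic_on disc" and g: "g holomorphic_on disc" and \<phi>: "\<phi> ` disc \<subseteq> disc"
  shows "volterra g \<phi> (\<lambda>z. c * f z) = (\<lambda>z. c * volterra g \<phi> f z)"
proof -
  have "(\<lambda>\<xi>. f \<xi> * deriv g \<xi>) contour_integrable_on linepath 0 (\<phi> z)" if "z \<in> disc" for z
  proof -
    have "\<phi> z \<in> disc" using \<phi> that by blast
    then have "closed_segment 0 (\<phi> z) \<subseteq> disc"
      by (rule segment_subset_disc)
    moreover have "(\<lambda>w. f w * deriv g w) holomorphic_on disc"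
      by (intro holomorphic_intros f holomorphic_deriv g) auto
    ultimately show ?thesis
      by (intro contour_integrable_continuous_linepath)
         (meson continuous_on_subset holomorphic_on_imp_continuous_on)
  qed
  then show ?thesis
    unfolding volterra_def on_disc_def
    by (intro ext) (simp add: contour_integral_lmul mult.assoc)
qed

section \<open>The unit ball and point evaluations\<close>

lemma eval_norm_eq: "eval_norm X N z = (SUP f\<in>closed_unit_ball X N. ennreal (cmod (f z)))"
  by (simp add: eval_norm_def op_norm_def)

text \<open>The functions bounded by \<open>n\<close> on \<open>K\<close> form an increasing sequence of open sets that covers all of
  \<^term>\<open>H_disc\<close>, so by compactness a single one of them contains the unit ball.\<close>

lemma unit_ball_uniformly_bounded:
  assumes comp: "compactin compact_open (closed_unit_ball X N)" and sub: "X \<subseteq> H_disc"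
    and K: "compact K" "K \<subseteq> disc"
  obtains B where "0 \<le> B" "\<And>f z. f \<in> closed_unit_ball X N \<Longrightarrow> z \<in> K \<Longrightarrow> cmod (f z) \<le> B"
proof -
  define U where "U n = {f \<in> H_disc. f ` K \<subseteq> ball 0 (real n)}" for n :: nat
  have op: "openin compact_open (U n)" for n
    unfolding U_def compact_open_def
    by (intro topology_generated_by_Basis) (use K in blast)
  have cover: "closed_unit_ball X N \<subseteq> \<Union>(range U)"
  proof
    fix f assume "f \<in> closed_unit_ball X N"
    then have f: "f \<in> H_disc" using sub by (auto simp: closed_unit_ball_def)
    then have "continuous_on K f"
      using K(2) by (auto simp: H_disc_def intro: continuous_on_subset holomorphic_on_imp_continuous_on)
    then have "bounded (f ` K)"
      using K(1) by (intro compact_imp_bounded compact_continuous_image)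
    then obtain b where b: "\<And>x. x \<in> K \<Longrightarrow> cmod (f x) \<le> b"
      by (auto simp: bounded_iff)
    obtain n :: nat where "b < real n" using reals_Archimedean2 by blast
    then have "f \<in> U n" using f b by (fastforce simp: U_def)
    then show "f \<in> \<Union>(range U)" by blast
  qed
  obtain F where F: "finite F" "F \<subseteq> range U" "closed_unit_ball X N \<subseteq> \<Union>F"
    using compactinD[OF comp _ cover] op by blast
  obtain I where I: "finite I" "F = U ` I"
    using F(1,2) by (meson finite_subset_image)
  show thesis
  proof (rule that[of "real (Max (insert 0 I))"])
    fix f z assume "f \<in> closed_unit_ball X N" "z \<in> K"
    then obtain n where n: "n \<in> I" "f \<in> U n" using F(3) I(2) by auto
    have "cmod (f z) \<le> real n"
      using n(2) \<open>z \<in> K\<close> by (force simp: U_def)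
    also have "real n \<le> real (Max (insert 0 I))"
      using I(1) n(1) by (intro of_nat_mono Max_ge) auto
    finally show "cmod (f z) \<le> real (Max (insert 0 I))" .
  qed auto
qed

lemma volterra_at_0_bounded:
  assumes comp: "compactin compact_open (closed_unit_ball X N)" and sub: "X \<subseteq> H_disc"
    and g: "g holomorphic_on disc" and \<phi>: "\<phi> ` disc \<subseteq> disc"
  obtains B where "0 \<le> B" "\<And>f. f \<in> closed_unit_ball X N \<Longrightarrow> cmod (volterra g \<phi> f 0) \<le> B"
proof -
  define K where "K = closed_segment 0 (\<phi> 0)"
  have \<phi>0: "\<phi> 0 \<in> disc" using \<phi> by (rule subsetD) simp
  have K: "compact K" "K \<subseteq> disc"
    using segment_subset_disc[OF \<phi>0] by (auto simp: K_def)
  obtain A where A: "0 \<le> A" "\<And>f z. f \<in> closed_unit_ball X N \<Longrightarrow> z \<in> K \<Longrightarrow> cmod (f z) \<le> A"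
    using unit_ball_uniformly_bounded[OF comp sub K] by blast
  have dg: "deriv g holomorphic_on disc" using g by (intro holomorphic_deriv) auto
  then have "bounded (deriv g ` K)"
    using K by (meson compact_continuous_image compact_imp_bounded continuous_on_subset
        holomorphic_on_imp_continuous_on)
  then obtain D where D: "0 < D" "\<And>x. x \<in> K \<Longrightarrow> cmod (deriv g x) \<le> D"
    by (auto simp: bounded_pos)
  show thesis
  proof (rule that[of "A * D * cmod (\<phi> 0)"])
    show "0 \<le> A * D * cmod (\<phi> 0)" using A D by auto
    fix f assume f: "f \<in> closed_unit_ball X N"
    then have hol: "(\<lambda>\<xi>. f \<xi> * deriv g \<xi>) holomorphic_on disc"
      using sub dg by (auto simp: closed_unit_ball_def H_disc_def intro!: holomorphic_intros)
    have "(\<lambda>\<xi>. f \<xi> * deriv g \<xi>) contour_integrable_on linepath 0 (\<phi> 0)"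
      using hol K unfolding K_def
      by (meson contour_integrable_continuous_linepath continuous_on_subset
          holomorphic_on_imp_continuous_on)
    then have "cmod (contour_integral (linepath 0 (\<phi> 0)) (\<lambda>\<xi>. f \<xi> * deriv g \<xi>))
        \<le> A * D * cmod (\<phi> 0 - 0)"
      by (rule contour_integral_bound_linepath)
         (use A D f in \<open>auto simp: K_def norm_mult intro!: mult_mono\<close>)
    then show "cmod (volterra g \<phi> f 0) \<le> A * D * cmod (\<phi> 0)"
      by (simp add: volterra_def on_disc_def)
  qed
qed

text \<open>Homogeneity transfers the membership in \<open>Y\<close> from the unit ball to the whole of \<open>X\<close>, so the
  operator norm can be estimated on the ball alone.\<close>

lemma op_norm_volterra_le:
  assumes X: "analytic_banach_space X N"
    and g: "g holomorphic_on disc" and \<phi>: "\<phi> ` disc \<subseteq> disc"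
    and Y: "\<And>c F. F \<in> Y \<Longrightarrow> (\<lambda>z. c * F z) \<in> Y"
    and mem: "\<And>f. f \<in> closed_unit_ball X N \<Longrightarrow> volterra g \<phi> f \<in> Y"
    and le: "\<And>f. f \<in> closed_unit_ball X N \<Longrightarrow> nY (volterra g \<phi> f) \<le> B"
  shows "op_norm X N Y nY (volterra g \<phi>) \<le> B"
proof -
  interpret analytic_banach_space X N by fact
  have "volterra g \<phi> f \<in> Y" if f: "f \<in> X" for f
  proof -
    \<comment> \<open>Dividing by \<open>N f + 1\<close> in place of \<open>N f\<close> also covers the zero function.\<close>
    define c where "c = complex_of_real (N f + 1)"
    have Nf: "0 \<le> N f" using f by (rule norm_nonneg)
    then have c: "c \<noteq> 0" "cmod c = N f + 1" by (auto simp: c_def simp flip: of_real_add)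
    have "cmod (inverse c) * N f \<le> 1"
      using Nf by (simp only: norm_inverse c) (simp add: divide_simps)
    then have h: "(\<lambda>z. inverse c * f z) \<in> closed_unit_ball X N"
      using scale_mem[OF f] norm_scale[OF f] by (simp only: closed_unit_ball_def mem_Collect_eq)
    then have "(\<lambda>z. inverse c * f z) holomorphic_on disc"
      using subset_H by (auto simp: closed_unit_ball_def H_disc_def)
    note volterra_scale[OF this g \<phi>, of c]
    moreover have "(\<lambda>z. c * (inverse c * f z)) = f"
      using c(1) by (intro ext) simp
    ultimately have "volterra g \<phi> f = (\<lambda>z. c * volterra g \<phi> (\<lambda>z. inverse c * f z) z)"
      by metis
    then show ?thesis using Y[OF mem[OF h]] by simp
  qed
  then show ?thesis using le by (auto simp: op_norm_def intro!: SUP_least)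
qed

lemma Hv_scale:
  assumes "F \<in> Hv v" "\<And>z. z \<in> disc \<Longrightarrow> 0 < v z"
  shows "(\<lambda>z. c * F z) \<in> Hv v"
proof -
  have "Hv_norm v (\<lambda>z. c * F z) = ennreal (cmod c) * Hv_norm v F"
    unfolding Hv_norm_def SUP_mult_left_ennreal using assms(2)
    by (intro SUP_cong) (auto simp: norm_mult mult_ac simp flip: ennreal_mult')
  then show ?thesis
    using assms(1) by (auto simp: Hv_def H_disc_def ennreal_mult_less_top intro!: holomorphic_intros)
qed

lemma Bv_scale:
  assumes F: "F \<in> Bv v" and v: "\<And>z. z \<in> disc \<Longrightarrow> 0 < v z"
  shows "(\<lambda>z. c * F z) \<in> Bv v"
proof -
  have hol: "F holomorphic_on disc" using F by (auto simp: Bv_def H_disc_def)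
  have "deriv (\<lambda>z. c * F z) z = c * deriv F z" if "z \<in> disc" for z
    using holomorphic_on_imp_differentiable_at[OF hol open_ball that] by (rule deriv_cmult)
  then have "(SUP z\<in>disc. ennreal (v z * cmod (deriv (\<lambda>z. c * F z) z)))
      = ennreal (cmod c) * (SUP z\<in>disc. ennreal (v z * cmod (deriv F z)))"
    unfolding SUP_mult_left_ennreal using v
    by (intro SUP_cong) (auto simp: norm_mult mult_ac simp flip: ennreal_mult')
  then have "Bv_norm v (\<lambda>z. c * F z) = ennreal (cmod c) * Bv_norm v F"
    by (simp add: Bv_norm_def norm_mult ennreal_mult distrib_left)
  then show ?thesis
    using F by (auto simp: Bv_def H_disc_def ennreal_mult_less_top intro!: holomorphic_intros)
qed

section \<open>Normal weights along dyadic radii\<close>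

definition dyadic :: "nat \<Rightarrow> real" where
  "dyadic n = 1 - 1 / 2 ^ n"

lemma dyadic_bounds: "0 \<le> dyadic n" "dyadic n < 1" "dyadic n \<le> dyadic (Suc n)"
  by (auto simp: dyadic_def field_simps)

lemma of_real_dyadic: "complex_of_real (dyadic n) = 1 - 1 / 2 ^ n"
  by (simp add: dyadic_def)

lemma dyadic_bracket:
  assumes "0 \<le> r" "r < 1"
  obtains n where "dyadic n \<le> r" "r < dyadic (Suc n)"
proof -
  obtain m where "(1 / 2) ^ m < 1 - r"
    using real_arch_pow_inv[of "1 - r" "1/2"] assms by auto
  then have "r < dyadic m" by (simp add: dyadic_def power_one_over)
  define n where "n = (LEAST m. r < dyadic m)"
  have n: "r < dyadic n" unfolding n_def by (rule LeastI) fact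
  then have "n \<noteq> 0" using assms by (intro notI) (simp add: dyadic_def)
  then obtain k where k: "n = Suc k" using not0_implies_Suc by blast
  then have "\<not> r < dyadic k" using not_less_Least[of k "\<lambda>m. r < dyadic m"] by (auto simp: n_def)
  then show thesis using that[of k] n k by auto
qed

lemma normal_weight_antimono:
  assumes v: "normal_weight v" and w: "w \<in> disc" and le: "cmod z \<le> cmod w"
  shows "v w \<le> v z"
proof -
  have "z \<in> disc" using w le by simp
  moreover have "\<forall>z\<in>disc. \<forall>w\<in>disc. cmod z \<le> cmod w \<longrightarrow> v w \<le> v z"
    using v unfolding normal_weight_def by blast
  ultimately show ?thesis using w le by blast
qed

lemma normal_weight_pos: "normal_weight v \<Longrightarrow> z \<in> disc \<Longrightarrow> 0 < v z"
  unfolding normal_weight_def weight_def by blast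

lemma normal_weight_dyadic_doubling:
  assumes v: "normal_weight v"
  obtains C where "0 < C" "\<And>n. v (of_real (dyadic n)) \<le> C * v (of_real (dyadic (Suc n)))"
proof -
  have "(SUP n::nat. ereal (v (1 - 1 / 2 ^ n) / v (1 - 1 / 2 ^ (n + 1)))) < \<infinity>"
    using v unfolding normal_weight_def by blast
  then obtain C where C: "(SUP n::nat. ereal (v (1 - 1 / 2 ^ n) / v (1 - 1 / 2 ^ (n + 1)))) < ereal C"
    using ereal_dense2 by blast
  have pos: "0 < v (of_real (dyadic n))" for n
    using dyadic_bounds[of n] by (intro normal_weight_pos[OF v]) auto
  have C': "v (of_real (dyadic n)) / v (of_real (dyadic (Suc n))) < C" for n
  proof -
    have "ereal (v (1 - 1 / 2 ^ n) / v (1 - 1 / 2 ^ (n + 1))) < ereal C"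
      using C by (rule le_less_trans[rotated]) (rule SUP_upper, simp)
    then show ?thesis unfolding of_real_dyadic by simp
  qed
  show thesis
  proof (rule that[of C])
    show "0 < C" using C'[of 0] pos[of 0] pos[of "Suc 0"]
      by (meson divide_pos_pos less_trans)
    show "v (of_real (dyadic n)) \<le> C * v (of_real (dyadic (Suc n)))" for n
      using C'[of n] pos[of "Suc n"] by (simp add: divide_simps)
  qed
qed

text \<open>If \<open>cmod z\<close> lies between \<open>dyadic n\<close> and \<open>dyadic (Suc n)\<close>, then a point at no less than half the
  distance of \<open>z\<close> to the boundary lies within \<open>dyadic (Suc (Suc n))\<close>, so two dyadic steps suffice.\<close>

lemma normal_weight_doubling:
  assumes v: "normal_weight v"
  obtains C where "0 < C"
    "\<And>z w. z \<in> disc \<Longrightarrow> w \<in> disc \<Longrightarrow> 1 - cmod z \<le> 2 * (1 - cmod w) \<Longrightarrow> v z \<le> C * v w"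
proof -
  obtain C where C: "0 < C" "\<And>n. v (of_real (dyadic n)) \<le> C * v (of_real (dyadic (Suc n)))"
    using normal_weight_dyadic_doubling[OF v] by blast
  show thesis
  proof (rule that[of "C * C"])
    show "0 < C * C" using C(1) by simp
    fix z w :: complex assume zw: "z \<in> disc" "w \<in> disc" "1 - cmod z \<le> 2 * (1 - cmod w)"
    obtain n where n: "dyadic n \<le> cmod z" "cmod z < dyadic (Suc n)"
      using dyadic_bracket[of "cmod z"] zw by auto
    have "1 - dyadic (Suc n) = 2 * (1 - dyadic (Suc (Suc n)))"
      by (simp add: dyadic_def)
    then have "cmod w \<le> dyadic (Suc (Suc n))"
      using zw(3) n(2) by (simp add: algebra_simps)
    then have w: "v (of_real (dyadic (Suc (Suc n)))) \<le> v w"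
      using dyadic_bounds[of "Suc (Suc n)"] by (intro normal_weight_antimono[OF v]) auto
    have "v z \<le> v (of_real (dyadic n))"
      using n zw dyadic_bounds[of n] by (intro normal_weight_antimono[OF v]) auto
    also have "\<dots> \<le> C * v (of_real (dyadic (Suc n)))" by (rule C)
    also have "\<dots> \<le> C * (C * v (of_real (dyadic (Suc (Suc n)))))"
      using C by (intro mult_left_mono) auto
    also have "\<dots> \<le> C * (C * v w)" using C(1) w by (intro mult_left_mono) auto
    finally show "v z \<le> C * C * v w" by (simp add: mult.assoc)
  qed
qed

text \<open>Let \<open>s m\<close> denote the product to be bounded. Splitting off the last \<open>k\<close> summands, each of which
  contributes at most 1, leaves \<open>s m \<le> q * s (m - k) + k\<close>. This recursion preserves every
  bound \<open>D \<ge> k / (1 - q)\<close>.\<close>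

lemma reciprocal_sum_of_geometric_decay:
  fixes u :: "nat \<Rightarrow> real"
  assumes pos: "\<And>n. 0 < u n" and dec: "decseq u"
    and q: "q < 1" and decay: "\<And>n. n \<ge> n0 \<Longrightarrow> u (n + k) \<le> q * u n"
  obtains D where "0 \<le> D" "\<And>m. u m * (\<Sum>j\<le>m. 1 / u j) \<le> D"
proof -
  have q0: "0 < q"
    using decay[of n0] pos[of n0] pos[of "n0 + k"] by (metis order_less_le_trans order_refl zero_less_mult_pos2)
  have k: "0 < k"
  proof (rule ccontr)
    assume "\<not> 0 < k"
    then have "u n0 \<le> q * u n0" using decay[of n0] by simp
    then show False using pos[of n0] q by simp
  qed
  have ratio_le_1: "u m / u j \<le> 1" if "j \<le> m" for j m
    using pos[of j] decseqD[OF dec that] by simp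
  \<comment> \<open>The first summand bounds the initial products, with at most \<open>n0 + k\<close> terms; the second is
    the fixed point of the recursion.\<close>
  define D where "D = real (n0 + k) + real k / (1 - q)"
  have "u m * (\<Sum>j\<le>m. 1 / u j) \<le> D" for m
  proof (induction m rule: less_induct)
    case (less m)
    show ?case
    proof (cases "m < n0 + k")
      case True
      have "u m * (\<Sum>j\<le>m. 1 / u j) = (\<Sum>j\<le>m. u m / u j)" by (simp add: sum_distrib_left)
      also have "\<dots> \<le> real (card {..m}) * 1" by (rule sum_bounded_above) (use ratio_le_1 in auto)
      also have "\<dots> \<le> real (n0 + k)" using True by simp
      also have "\<dots> \<le> D" using q by (simp add: D_def)
      finally show ?thesis .
    next
      case False
      define l where "l = m - k"
      have l: "m = l + k" "n0 \<le> l" "l < m" using False k by (auto simp: l_def)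
      have split: "{..m} = {..l} \<union> {l<..m}" using l by auto
      have "u m * (\<Sum>j\<le>m. 1 / u j) = u m * (\<Sum>j\<le>l. 1 / u j) + (\<Sum>j\<in>{l<..m}. u m / u j)"
        unfolding split by (subst sum.union_disjoint) (auto simp: distrib_left sum_distrib_left)
      also have "(\<Sum>j\<in>{l<..m}. u m / u j) \<le> real (card {l<..m}) * 1"
        by (rule sum_bounded_above) (use ratio_le_1 in auto)
      also have "real (card {l<..m}) * 1 = k" using l by simp
      also have "u m * (\<Sum>j\<le>l. 1 / u j) \<le> q * u l * (\<Sum>j\<le>l. 1 / u j)"
        using decay[OF l(2)] l(1) pos by (intro mult_right_mono sum_nonneg) (auto intro: less_imp_le)
      also have "\<dots> \<le> q * D" using less[OF l(3)] q0 by simp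
      also have "q * D + real k \<le> D"
      proof -
        have "real k / (1 - q) \<le> D" by (simp add: D_def)
        then have "real k \<le> D * (1 - q)" using q by (simp add: divide_simps)
        then show ?thesis by (simp add: algebra_simps)
      qed
      finally show ?thesis by simp
    qed
  qed
  moreover have "0 \<le> D" using q by (simp add: D_def)
  ultimately show thesis using that by blast
qed

lemma normal_weight_reciprocal_sum:
  assumes v: "normal_weight v"
  obtains D where "0 \<le> D"
    "\<And>m. v (of_real (dyadic m)) * (\<Sum>j\<le>m. 1 / v (of_real (dyadic j))) \<le> D"
proof -
  define u where "u n = v (of_real (dyadic n))" for n
  have pos: "0 < u n" for n
    unfolding u_def using dyadic_bounds[of n] by (intro normal_weight_pos[OF v]) auto
  have dec: "decseq u"
    unfolding u_def decseq_Suc_iff using dyadic_bounds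
    by (auto intro!: normal_weight_antimono[OF v])
  have "(INF k::nat. limsup (\<lambda>n. ereal (u (n + k) / u n))) < 1"
    using v unfolding normal_weight_def u_def of_real_dyadic by blast
  then obtain k where "limsup (\<lambda>n. ereal (u (n + k) / u n)) < 1"
    by (auto simp: INF_less_iff)
  then obtain q where q: "limsup (\<lambda>n. ereal (u (n + k) / u n)) < ereal q" "ereal q < 1"
    using ereal_dense2 by blast
  then obtain n0 where n0: "\<And>n. n \<ge> n0 \<Longrightarrow> ereal (u (n + k) / u n) < ereal q"
    using Limsup_lessD[OF q(1)] unfolding eventually_sequentially by blast
  have "u (n + k) \<le> q * u n" if "n \<ge> n0" for n
    using n0[OF that] pos[of n] by (simp add: divide_simps)
  moreover have "q < 1" using q(2) by simp
  ultimately show thesis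
    using reciprocal_sum_of_geometric_decay[OF pos dec] that unfolding u_def by metis
qed

section \<open>Growth of a function and of its derivative\<close>

text \<open>On the circle about \<open>z\<close> of radius \<open>(1 - cmod z) / 2\<close> the distance to the boundary is at least half
  of that at \<open>z\<close>, so there the weight is at least a fixed multiple of \<open>v z\<close>. Cauchy's inequality on
  this circle costs the factor \<open>2 / (1 - cmod z)\<close>.\<close>

lemma weighted_Cauchy_estimate:
  assumes v: "normal_weight v"
  obtains c where "0 < c" "\<And>F z. F holomorphic_on disc \<Longrightarrow> z \<in> disc \<Longrightarrow>
    ennreal ((1 - cmod z) * v z * cmod (deriv F z)) \<le> ennreal c * Hv_norm v F"
proof -
  obtain C where C: "0 < C"
    "\<And>z w. z \<in> disc \<Longrightarrow> w \<in> disc \<Longrightarrow> 1 - cmod z \<le> 2 * (1 - cmod w) \<Longrightarrow> v z \<le> C * v w"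
    using normal_weight_doubling[OF v] by blast
  show thesis
  proof (rule that[of "2 * C"])
    show "0 < 2 * C" using C(1) by simp
    fix F z assume F: "F holomorphic_on disc" and z: "z \<in> disc"
    show "ennreal ((1 - cmod z) * v z * cmod (deriv F z)) \<le> ennreal (2 * C) * Hv_norm v F"
    proof (cases "Hv_norm v F")
      case top
      then show ?thesis using C(1) by (simp add: ennreal_mult_top)
    next
      case (real M)
      define r where "r = (1 - cmod z) / 2"
      have r: "0 < r" using z by (simp add: r_def)
      have vz: "0 < v z" using z by (rule normal_weight_pos[OF v])
      have in_disc: "1 - cmod z \<le> 2 * (1 - cmod w)" "w \<in> disc" if "cmod (z - w) \<le> r" for w
      proof -
        have "cmod w \<le> cmod z + r"
          using that norm_triangle_sub[of w z] by (simp add: norm_minus_commute)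
        moreover have "2 * r = 1 - cmod z" by (simp add: r_def)
        ultimately show "1 - cmod z \<le> 2 * (1 - cmod w)" by (simp add: algebra_simps)
        then show "w \<in> disc" using z by simp
      qed
      then have sub: "cball z r \<subseteq> disc" by (auto simp: dist_norm)
      have bound: "cmod (F w) \<le> C * M / v z" if w: "cmod (z - w) = r" for w
      proof -
        have wd: "w \<in> disc" using w by (intro in_disc) simp
        have "ennreal (v w * cmod (F w)) \<le> Hv_norm v F"
          unfolding Hv_norm_def using wd by (rule SUP_upper)
        then have "v w * cmod (F w) \<le> M" using real by simp
        moreover have "v z \<le> C * v w"
          using w z wd in_disc[of w] by (intro C) auto
        then have "v z * cmod (F w) \<le> C * v w * cmod (F w)" by (intro mult_right_mono) auto
        ultimately have "v z * cmod (F w) \<le> C * M"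
          using C(1) by (smt (verit) mult.assoc mult_left_mono)
        then show ?thesis using vz by (simp add: field_simps)
      qed
      have "cmod ((deriv ^^ 1) F z) \<le> fact 1 * (C * M / v z) / r ^ 1"
        using sub r bound
        by (intro Cauchy_inequality holomorphic_on_subset[OF F]
              continuous_on_subset[OF holomorphic_on_imp_continuous_on[OF F]]) auto
      then have "r * v z * cmod (deriv F z) \<le> C * M"
        using r vz by (simp add: field_simps)
      then have "(1 - cmod z) * v z * cmod (deriv F z) \<le> 2 * C * M"
        by (simp add: r_def)
      then show ?thesis
        using C(1) real by (simp add: ennreal_leI flip: ennreal_mult)
    qed
  qed
qed

text \<open>A point between the radii \<open>dyadic m\<close> and \<open>dyadic (Suc m)\<close> is reached from its radial projection
  to the smaller circle by a path of length at most \<open>1 / 2 ^ Suc m\<close>. On this path the factor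
  \<open>1 - cmod z\<close> is at least \<open>1 / 2 ^ Suc m\<close>, so the two powers of 2 cancel and the increment of \<open>F\<close> is at
  most \<open>M\<close> over the weight at the larger radius.\<close>

lemma growth_along_dyadic_radii:
  assumes v: "normal_weight v" and F: "F holomorphic_on disc" and M: "0 \<le> M"
    and dF: "\<And>z. z \<in> disc \<Longrightarrow> (1 - cmod z) * v z * cmod (deriv F z) \<le> M"
    and z: "cmod z \<le> dyadic m"
  shows "cmod (F z - F 0) \<le> M * (\<Sum>j\<le>m. 1 / v (of_real (dyadic j)))"
  using z
proof (induction m arbitrary: z)
  case 0
  then show ?case using M normal_weight_pos[OF v, of 0] by (simp add: dyadic_def)
next
  case (Suc m)
  define u where "u = v (of_real (dyadic (Suc m)))"
  \<comment> \<open>\<open>w\<close> is the radial projection of \<open>z\<close> to the disc of radius \<open>dyadic m\<close>.\<close>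
  define a where "a = (if cmod z \<le> dyadic m then 1 else dyadic m / cmod z)"
  define w where "w = of_real a * z"
  have a: "0 \<le> a" "a \<le> 1" using dyadic_bounds[of m] by (auto simp: a_def divide_simps)
  have w: "cmod w \<le> dyadic m" using dyadic_bounds[of m] a
    by (auto simp: w_def a_def norm_mult)
  have u: "0 < u" unfolding u_def using dyadic_bounds[of "Suc m"]
    by (intro normal_weight_pos[OF v]) auto
  have "z - w = of_real (1 - a) * z" by (simp add: w_def algebra_simps)
  then have "cmod (z - w) = (1 - a) * cmod z" using a by (simp only: norm_mult norm_of_real)
  also have "\<dots> \<le> dyadic (Suc m) - dyadic m"
    using Suc.prems dyadic_bounds[of m] by (auto simp: a_def divide_simps algebra_simps)
  also have "\<dots> = 1 / 2 ^ Suc m" by (simp add: dyadic_def)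
  finally have zw: "cmod (z - w) \<le> 1 / 2 ^ Suc m" .
  have step: "cmod (F z - F w) \<le> M * 2 ^ Suc m / u * cmod (z - w)"
  proof (rule field_differentiable_bound[where S = "cball 0 (dyadic (Suc m))"])
    fix x :: complex assume "x \<in> cball 0 (dyadic (Suc m))"
    then have x: "cmod x \<le> dyadic (Suc m)" "x \<in> disc" using dyadic_bounds[of "Suc m"] by auto
    show "(F has_field_derivative deriv F x) (at x within cball 0 (dyadic (Suc m)))"
      using F x by (auto intro: holomorphic_derivI has_field_derivative_at_within)
    have "u \<le> v x" unfolding u_def using x dyadic_bounds[of "Suc m"]
      by (intro normal_weight_antimono[OF v]) auto
    moreover have "1 / 2 ^ Suc m \<le> 1 - cmod x" using x by (simp add: dyadic_def)
    ultimately have "1 / 2 ^ Suc m * u \<le> (1 - cmod x) * v x"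
      using u x by (intro mult_mono) auto
    then have "1 / 2 ^ Suc m * u * cmod (deriv F x) \<le> M"
      using dF[OF x(2)] by (meson mult_right_mono norm_ge_zero order_trans)
    then show "cmod (deriv F x) \<le> M * 2 ^ Suc m / u" using u by (simp add: field_simps)
  qed (use Suc.prems w dyadic_bounds[of m] in auto)
  also have "\<dots> \<le> M * 2 ^ Suc m / u * (1 / 2 ^ Suc m)"
    using zw M u by (intro mult_left_mono) auto
  also have "\<dots> = M / u" by simp
  finally have "cmod (F z - F w) \<le> M / u" .
  moreover have "cmod (F w - F 0) \<le> M * (\<Sum>j\<le>m. 1 / v (of_real (dyadic j)))"
    using Suc.IH[OF w] .
  moreover have "cmod (F z - F 0) \<le> cmod (F z - F w) + cmod (F w - F 0)"
    by (metis diff_add_cancel diff_add_eq norm_triangle_ineq add_diff_eq)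
  ultimately show ?case by (simp add: u_def distrib_left)
qed

text \<open>The parameter \<open>A\<close> separates the value at 0, which for the Volterra operator is
  controlled by compactness, from the derivative, which is controlled by the evaluation
  functionals.\<close>

lemma weighted_growth_estimate:
  assumes v: "normal_weight v"
  obtains c where "0 < c" "\<And>F A S. F holomorphic_on disc \<Longrightarrow> cmod (F 0) \<le> A \<Longrightarrow>
    (\<And>z. z \<in> disc \<Longrightarrow> ennreal ((1 - cmod z) * v z * cmod (deriv F z)) \<le> S) \<Longrightarrow>
    Hv_norm v F \<le> ennreal c * (ennreal A + S)"
proof -
  obtain C where C: "0 < C" "\<And>n. v (of_real (dyadic n)) \<le> C * v (of_real (dyadic (Suc n)))"
    using normal_weight_dyadic_doubling[OF v] by blast
  obtain D where D: "0 \<le> D"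
    "\<And>m. v (of_real (dyadic m)) * (\<Sum>j\<le>m. 1 / v (of_real (dyadic j))) \<le> D"
    using normal_weight_reciprocal_sum[OF v] by blast
  define c where "c = v 0 + (D + C)"
  have v0: "0 < v 0" using normal_weight_pos[OF v, of 0] by simp
  have c: "0 < c" using v0 C(1) D(1) by (simp add: c_def)
  show thesis
  proof (rule that[OF c])
    fix F A S
    assume F: "F holomorphic_on disc" and A: "cmod (F 0) \<le> A"
      and S: "\<And>z. z \<in> disc \<Longrightarrow> ennreal ((1 - cmod z) * v z * cmod (deriv F z)) \<le> S"
    have A0: "0 \<le> A" using A norm_ge_zero order_trans by blast
    show "Hv_norm v F \<le> ennreal c * (ennreal A + S)"
    proof (cases S)
      case top
      then show ?thesis using c by (simp add: ennreal_mult_top)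
    next
      case (real M)
      have dF: "(1 - cmod z) * v z * cmod (deriv F z) \<le> M" if "z \<in> disc" for z
        using S[OF that] real by simp
      have "v z * cmod (F z) \<le> c * (A + M)" if z: "z \<in> disc" for z
      proof -
        obtain m where m: "dyadic m \<le> cmod z" "cmod z < dyadic (Suc m)"
          using dyadic_bracket[of "cmod z"] z by auto
        define u where "u n = v (of_real (dyadic n))" for n
        have upos: "0 < u n" for n
          unfolding u_def using dyadic_bounds[of n] by (intro normal_weight_pos[OF v]) auto
        have vz: "0 < v z" using z by (rule normal_weight_pos[OF v])
        have vum: "v z \<le> u m" unfolding u_def using m dyadic_bounds[of m] z
          by (intro normal_weight_antimono[OF v]) auto
        have vz0: "v z \<le> v 0" using z by (intro normal_weight_antimono[OF v]) auto
        \<comment> \<open>The chain to \<open>z\<close> ends one radius beyond \<open>dyadic m\<close>, whereas \<open>v z\<close> is only known to be at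
          most \<open>u m\<close>; doubling pays for the extra summand.\<close>
        have "u m * (\<Sum>j\<le>Suc m. 1 / u j) = u m * (\<Sum>j\<le>m. 1 / u j) + u m / u (Suc m)"
          by (simp add: distrib_left)
        also have "\<dots> \<le> D + C"
          using D(2)[of m] C(2)[of m] upos[of "Suc m"]
          by (intro add_mono) (auto simp: u_def divide_simps)
        finally have sum: "u m * (\<Sum>j\<le>Suc m. 1 / u j) \<le> D + C" .
        have "cmod (F z - F 0) \<le> M * (\<Sum>j\<le>Suc m. 1 / u j)"
          unfolding u_def using m real by (intro growth_along_dyadic_radii[OF v F _ dF]) auto
        then have "v z * cmod (F z - F 0) \<le> u m * (M * (\<Sum>j\<le>Suc m. 1 / u j))"
          using vum upos[of m] by (intro mult_mono) auto
        also have "\<dots> = M * (u m * (\<Sum>j\<le>Suc m. 1 / u j))" by simp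
        also have "\<dots> \<le> M * (D + C)" using sum real by (intro mult_left_mono) auto
        finally have 1: "v z * cmod (F z - F 0) \<le> M * (D + C)" .
        have 2: "v z * cmod (F 0) \<le> v 0 * A" using vz0 A v0 by (intro mult_mono) auto
        have "v z * cmod (F z) \<le> v z * cmod (F z - F 0) + v z * cmod (F 0)"
          unfolding distrib_left[symmetric] using vz norm_triangle_sub[of "F z" "F 0"]
          by (intro mult_left_mono) auto
        also have "\<dots> \<le> M * (D + C) + v 0 * A" using 1 2 by simp
        also have "\<dots> \<le> c * (A + M)"
          using v0 C(1) D(1) A0 real by (simp add: c_def algebra_simps)
        finally show ?thesis .
      qed
      then show ?thesis
        using c A0 real unfolding Hv_norm_def
        by (intro SUP_least) (auto simp: ennreal_leI simp flip: ennreal_mult ennreal_plus)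
    qed
  qed
qed

section \<open>The norm estimates\<close>

text \<open>The derivative of \<open>T f\<close> at \<open>z\<close> is the evaluation of \<open>f\<close> at \<open>\<phi> z\<close> times a factor that does not
  involve \<open>f\<close>; taking the supremum over \<open>f\<close> first produces the evaluation norm, taking it last
  leaves the supremum over the unit ball of a weighted norm of the derivative of \<open>T f\<close>.\<close>

lemma weighted_eval_quantity_eq:
  assumes sub: "X \<subseteq> H_disc" and g: "g holomorphic_on disc"
    and \<phi>: "\<phi> holomorphic_on disc" "\<phi> ` disc \<subseteq> disc"
    and a: "\<And>z. z \<in> disc \<Longrightarrow> 0 \<le> a z"
  shows "(SUP z\<in>disc. ennreal (a z * cmod (deriv (g \<circ> \<phi>) z)) * eval_norm X N (\<phi> z))
    = (SUP f\<in>closed_unit_ball X N. SUP z\<in>disc. ennreal (a z * cmod (deriv (volterra g \<phi> f) z)))"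
proof -
  have "ennreal (a z * cmod (deriv (g \<circ> \<phi>) z)) * eval_norm X N (\<phi> z)
      = (SUP f\<in>closed_unit_ball X N. ennreal (a z * cmod (deriv (volterra g \<phi> f) z)))"
    if z: "z \<in> disc" for z
    unfolding eval_norm_eq SUP_mult_left_ennreal
  proof (rule SUP_cong[OF refl])
    fix f assume "f \<in> closed_unit_ball X N"
    then have "f holomorphic_on disc" using sub by (auto simp: closed_unit_ball_def H_disc_def)
    then have "deriv (volterra g \<phi> f) z = f (\<phi> z) * deriv (g \<circ> \<phi>) z"
      using volterra_has_derivative[OF _ g \<phi> z] by (intro DERIV_imp_deriv)
    then show "ennreal (a z * cmod (deriv (g \<circ> \<phi>) z)) * ennreal (cmod (f (\<phi> z)))
        = ennreal (a z * cmod (deriv (volterra g \<phi> f) z))"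
      using a[OF z] by (simp add: norm_mult mult_ac flip: ennreal_mult)
  qed
  then show ?thesis
    by (subst SUP_commute) (rule SUP_cong[OF refl])
qed

text \<open>When \<open>T\<close> does not map \<open>X\<close> into \<open>Y\<close> the right-hand side is infinite.\<close>

lemma le_op_norm: "f \<in> closed_unit_ball X N \<Longrightarrow> nY (T f) \<le> op_norm X N Y nY T"
  by (auto simp: op_norm_def intro: SUP_upper)

context
  fixes v :: "complex \<Rightarrow> real" and X N g \<phi>
  assumes weight: "weight v" and admissible: "admissible_space X N" and g_H: "g \<in> H_disc"
    and \<phi>_hol: "\<phi> holomorphic_on disc" and \<phi>_disc: "\<phi> ` disc \<subseteq> disc"
begin

lemma v_pos: "z \<in> disc \<Longrightarrow> 0 < v z"
  using weight by (simp add: weight_def)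

lemma banach: "analytic_banach_space X N"
  using admissible by (simp add: admissible_space_def)

lemma X_subset: "X \<subseteq> H_disc"
  using banach by (rule analytic_banach_space.subset_H)

lemma g_hol: "g holomorphic_on disc"
  using g_H by (simp add: H_disc_def)

lemma ball_hol: "f \<in> closed_unit_ball X N \<Longrightarrow> f holomorphic_on disc"
  using X_subset by (auto simp: closed_unit_ball_def H_disc_def)

lemma volterra_H: "f \<in> closed_unit_ball X N \<Longrightarrow> volterra g \<phi> f \<in> H_disc"
  by (intro volterra_in_H_disc ball_hol g_hol \<phi>_hol \<phi>_disc)

text \<open>Choosing the bound 0 when \<open>\<phi> 0 = 0\<close> lets the boundedness of \<open>T\<close> and the upper bounds
  without the term \<open>T f 0\<close> follow from one estimate.\<close>

lemma volterra_at_0_bound: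
  obtains B where "0 \<le> B" "\<And>f. f \<in> closed_unit_ball X N \<Longrightarrow> cmod (volterra g \<phi> f 0) \<le> B"
    "\<phi> 0 = 0 \<Longrightarrow> B = 0"
proof (cases "\<phi> 0 = 0")
  case True
  then show thesis by (intro that[of 0]) (auto simp: volterra_def on_disc_def)
next
  case False
  have "compactin compact_open (closed_unit_ball X N)"
    using admissible by (simp add: admissible_space_def)
  then obtain B where "0 \<le> B" "\<And>f. f \<in> closed_unit_ball X N \<Longrightarrow> cmod (volterra g \<phi> f 0) \<le> B"
    using volterra_at_0_bounded[OF _ X_subset g_hol \<phi>_disc] by metis
  with False show thesis by (intro that[of B]) auto
qed

lemma Bv_quantity_eq:
  "Bv_quantity X N v g \<phi>
    = (SUP f\<in>closed_unit_ball X N. SUP z\<in>disc. ennreal (v z * cmod (deriv (volterra g \<phi> f) z)))"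
  unfolding Bv_quantity_def
  by (intro weighted_eval_quantity_eq X_subset g_hol \<phi>_hol \<phi>_disc less_imp_le v_pos)

lemma Hv_quantity_eq:
  "Hv_quantity X N v g \<phi> = (SUP f\<in>closed_unit_ball X N. SUP z\<in>disc.
     ennreal ((1 - cmod z) * v z * cmod (deriv (volterra g \<phi> f) z)))"
  unfolding Hv_quantity_def
  by (intro weighted_eval_quantity_eq X_subset g_hol \<phi>_hol \<phi>_disc mult_nonneg_nonneg
      less_imp_le[OF v_pos]) auto

lemma Bv_quantity_le_op_norm:
  "Bv_quantity X N v g \<phi> \<le> op_norm X N (Bv v) (Bv_norm v) (volterra g \<phi>)"
proof -
  have "(SUP z\<in>disc. ennreal (v z * cmod (deriv (volterra g \<phi> f) z)))
      \<le> op_norm X N (Bv v) (Bv_norm v) (volterra g \<phi>)" if "f \<in> closed_unit_ball X N" for f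
  proof (rule order_trans)
    show "(SUP z\<in>disc. ennreal (v z * cmod (deriv (volterra g \<phi> f) z)))
        \<le> Bv_norm v (volterra g \<phi> f)"
      by (simp add: Bv_norm_def)
  qed (rule le_op_norm[OF that])
  then show ?thesis
    unfolding Bv_quantity_eq by (rule SUP_least)
qed

lemma op_norm_Bv_le:
  assumes B: "\<And>f. f \<in> closed_unit_ball X N \<Longrightarrow> cmod (volterra g \<phi> f 0) \<le> B"
  shows "op_norm X N (Bv v) (Bv_norm v) (volterra g \<phi>) \<le> ennreal B + Bv_quantity X N v g \<phi>"
proof (cases "Bv_quantity X N v g \<phi> = \<infinity>")
  case False
  have le: "Bv_norm v (volterra g \<phi> f) \<le> ennreal B + Bv_quantity X N v g \<phi>"
    if f: "f \<in> closed_unit_ball X N" for f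
    unfolding Bv_norm_def Bv_quantity_eq
    by (intro add_mono ennreal_leI B f SUP_upper)
  also have "ennreal B + Bv_quantity X N v g \<phi> < \<infinity>"
    using False by (simp add: top.not_eq_extremum)
  finally show ?thesis using le
    by (intro op_norm_volterra_le banach g_hol \<phi>_disc Bv_scale v_pos)
       (auto simp: Bv_def intro: volterra_H)
qed simp

lemma Hv_quantity_le_op_norm:
  assumes c: "\<And>F z. F holomorphic_on disc \<Longrightarrow> z \<in> disc \<Longrightarrow>
    ennreal ((1 - cmod z) * v z * cmod (deriv F z)) \<le> ennreal c * Hv_norm v F"
  shows "Hv_quantity X N v g \<phi> \<le> ennreal c * op_norm X N (Hv v) (Hv_norm v) (volterra g \<phi>)"
  unfolding Hv_quantity_eq
proof (intro SUP_least)
  fix f and z :: complex assume f: "f \<in> closed_unit_ball X N" and z: "z \<in> disc"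
  have "ennreal ((1 - cmod z) * v z * cmod (deriv (volterra g \<phi> f) z))
      \<le> ennreal c * Hv_norm v (volterra g \<phi> f)"
    using volterra_H[OF f] z by (intro c) (auto simp: H_disc_def)
  also have "\<dots> \<le> ennreal c * op_norm X N (Hv v) (Hv_norm v) (volterra g \<phi>)"
    by (intro mult_left_mono le_op_norm f) simp
  finally show "ennreal ((1 - cmod z) * v z * cmod (deriv (volterra g \<phi> f) z))
      \<le> ennreal c * op_norm X N (Hv v) (Hv_norm v) (volterra g \<phi>)" .
qed

lemma op_norm_Hv_le:
  assumes B: "\<And>f. f \<in> closed_unit_ball X N \<Longrightarrow> cmod (volterra g \<phi> f 0) \<le> B"
    and c: "0 < c" "\<And>F A S. F holomorphic_on disc \<Longrightarrow> cmod (F 0) \<le> A \<Longrightarrow>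
      (\<And>z. z \<in> disc \<Longrightarrow> ennreal ((1 - cmod z) * v z * cmod (deriv F z)) \<le> S) \<Longrightarrow>
      Hv_norm v F \<le> ennreal c * (ennreal A + S)"
  shows "op_norm X N (Hv v) (Hv_norm v) (volterra g \<phi>)
    \<le> ennreal c * (ennreal B + Hv_quantity X N v g \<phi>)"
proof (cases "Hv_quantity X N v g \<phi> = \<infinity>")
  case True
  then show ?thesis using c(1) by (simp add: ennreal_mult_top)
next
  case False
  have le: "Hv_norm v (volterra g \<phi> f) \<le> ennreal c * (ennreal B + Hv_quantity X N v g \<phi>)"
    if f: "f \<in> closed_unit_ball X N" for f
  proof (rule c(2))
    show "volterra g \<phi> f holomorphic_on disc" using volterra_H[OF f] by (simp add: H_disc_def)
    show "ennreal ((1 - cmod z) * v z * cmod (deriv (volterra g \<phi> f) z)) \<le> Hv_quantity X N v g \<phi>"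
      if "z \<in> disc" for z
      unfolding Hv_quantity_eq using f that by (blast intro: SUP_upper2 SUP_upper)
  qed (rule B[OF f])
  also have "ennreal c * (ennreal B + Hv_quantity X N v g \<phi>) < \<infinity>"
    using False by (simp add: ennreal_mult_less_top top.not_eq_extremum)
  finally show ?thesis using le
    by (intro op_norm_volterra_le banach g_hol \<phi>_disc Hv_scale v_pos)
       (auto simp: Hv_def intro: volterra_H)
qed

lemma Bv_norm_equality:
  defines "T \<equiv> op_norm X N (Bv v) (Bv_norm v) (volterra g \<phi>)" and "S \<equiv> Bv_quantity X N v g \<phi>"
  shows "S \<le> T \<and> (S < \<infinity> \<longrightarrow> T < \<infinity>) \<and> (\<phi> 0 = 0 \<longrightarrow> T = S)"
proof -
  obtain B where B: "0 \<le> B" "\<And>f. f \<in> closed_unit_ball X N \<Longrightarrow> cmod (volterra g \<phi> f 0) \<le> B"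
    "\<phi> 0 = 0 \<Longrightarrow> B = 0"
    using volterra_at_0_bound by blast
  have T: "T \<le> ennreal B + S" unfolding T_def S_def using B(2) by (rule op_norm_Bv_le)
  have S: "S \<le> T" unfolding T_def S_def by (rule Bv_quantity_le_op_norm)
  have "T < \<infinity>" if "S < \<infinity>"
    using T by (rule le_less_trans) (use that in simp)
  moreover have "T = S" if "\<phi> 0 = 0"
    using T S B(3)[OF that] by simp
  ultimately show ?thesis using S by blast
qed

text \<open>The two constants are parameters here, so that they can be chosen from the weight before the
  space and the symbols.\<close>

lemma Hv_norm_equivalence:
  assumes c1: "\<And>F z. F holomorphic_on disc \<Longrightarrow> z \<in> disc \<Longrightarrow>
      ennreal ((1 - cmod z) * v z * cmod (deriv F z)) \<le> ennreal c1 * Hv_norm v F"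
    and c2: "0 < c2" "\<And>F A S. F holomorphic_on disc \<Longrightarrow> cmod (F 0) \<le> A \<Longrightarrow>
      (\<And>z. z \<in> disc \<Longrightarrow> ennreal ((1 - cmod z) * v z * cmod (deriv F z)) \<le> S) \<Longrightarrow>
      Hv_norm v F \<le> ennreal c2 * (ennreal A + S)"
  defines "T \<equiv> op_norm X N (Hv v) (Hv_norm v) (volterra g \<phi>)" and "S \<equiv> Hv_quantity X N v g \<phi>"
  shows "S \<le> ennreal (max c1 c2) * T \<and> (S < \<infinity> \<longrightarrow> T < \<infinity>) \<and>
    (\<phi> 0 = 0 \<longrightarrow> T \<le> ennreal (max c1 c2) * S)"
proof -
  obtain B where B: "0 \<le> B" "\<And>f. f \<in> closed_unit_ball X N \<Longrightarrow> cmod (volterra g \<phi> f 0) \<le> B"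
    "\<phi> 0 = 0 \<Longrightarrow> B = 0"
    using volterra_at_0_bound by blast
  have T: "T \<le> ennreal c2 * (ennreal B + S)"
    unfolding T_def S_def using B(2) c2 by (rule op_norm_Hv_le)
  have "S \<le> ennreal c1 * T"
    unfolding T_def S_def using c1 by (rule Hv_quantity_le_op_norm)
  also have "\<dots> \<le> ennreal (max c1 c2) * T" by (intro mult_right_mono ennreal_leI) auto
  finally have S: "S \<le> ennreal (max c1 c2) * T" .
  have "T < \<infinity>" if "S < \<infinity>"
    using T by (rule le_less_trans) (use that in \<open>simp add: ennreal_mult_less_top\<close>)
  moreover have "T \<le> ennreal (max c1 c2) * S" if "\<phi> 0 = 0"
  proof -
    have "T \<le> ennreal c2 * S" using T B(3)[OF that] by simp
    also have "\<dots> \<le> ennreal (max c1 c2) * S" by (intro mult_right_mono ennreal_leI) auto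
    finally show ?thesis .
  qed
  ultimately show ?thesis using S by blast
qed

end

theorem theorem3p3:
  fixes v :: "complex \<Rightarrow> real"
  assumes "weight v"
  shows
    "(normal_weight v \<longrightarrow>
       (\<exists>c::real. c > 0 \<and>
         (\<forall>X N g \<phi>. admissible_space X N \<longrightarrow> g \<in> H_disc \<longrightarrow>
            \<phi> holomorphic_on disc \<longrightarrow> \<phi> ` disc \<subseteq> disc \<longrightarrow>
            (let T = op_norm X N (Hv v) (Hv_norm v) (volterra g \<phi>);
                 S = Hv_quantity X N v g \<phi>
             in S \<le> ennreal c * T \<and> (S < \<infinity> \<longrightarrow> T < \<infinity>) \<and>
                (\<phi> 0 = 0 \<longrightarrow> T \<le> ennreal c * S)))))
     \<and>
     (\<forall>X N g \<phi>. admissible_space X N \<longrightarrow> g \<in> H_disc \<longrightarrow>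
        \<phi> holomorphic_on disc \<longrightarrow> \<phi> ` disc \<subseteq> disc \<longrightarrow>
        (let T = op_norm X N (Bv v) (Bv_norm v) (volterra g \<phi>);
             S = Bv_quantity X N v g \<phi>
         in S \<le> T \<and> (S < \<infinity> \<longrightarrow> T < \<infinity>) \<and> (\<phi> 0 = 0 \<longrightarrow> T = S)))"
proof (intro conjI impI allI)
  assume v: "normal_weight v"
  obtain c1 where c1: "0 < c1" "\<And>F z. F holomorphic_on disc \<Longrightarrow> z \<in> disc \<Longrightarrow>
      ennreal ((1 - cmod z) * v z * cmod (deriv F z)) \<le> ennreal c1 * Hv_norm v F"
    using weighted_Cauchy_estimate[OF v] by blast
  obtain c2 where c2: "0 < c2" "\<And>F A S. F holomorphic_on disc \<Longrightarrow> cmod (F 0) \<le> A \<Longrightarrow>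
      (\<And>z. z \<in> disc \<Longrightarrow> ennreal ((1 - cmod z) * v z * cmod (deriv F z)) \<le> S) \<Longrightarrow>
      Hv_norm v F \<le> ennreal c2 * (ennreal A + S)"
    using weighted_growth_estimate[OF v] by blast
  show "\<exists>c::real. c > 0 \<and>
         (\<forall>X N g \<phi>. admissible_space X N \<longrightarrow> g \<in> H_disc \<longrightarrow>
            \<phi> holomorphic_on disc \<longrightarrow> \<phi> ` disc \<subseteq> disc \<longrightarrow>
            (let T = op_norm X N (Hv v) (Hv_norm v) (volterra g \<phi>);
                 S = Hv_quantity X N v g \<phi>
             in S \<le> ennreal c * T \<and> (S < \<infinity> \<longrightarrow> T < \<infinity>) \<and>
                (\<phi> 0 = 0 \<longrightarrow> T \<le> ennreal c * S)))"
    unfolding Let_def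
    by (intro exI[of _ "max c1 c2"] conjI[OF _ allI] allI impI
          Hv_norm_equivalence[OF assms _ _ _ _ c1(2) c2])
       (use c1(1) in auto)
qed (unfold Let_def, rule Bv_norm_equality[OF assms])

end
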